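(* Let $n\geq 2$ be an integer. (1) If $n\not\equiv 0\pmod 3$, then for every prime power $q\geq 2$ there exists a scattered $\mathbb{F}_q$-linear set of rank $3n$ in $PG(2,q^{2n})$. (2) If $n\equiv 0\pmod 3$, then for every prime power $q\equiv 1\pmod 3$ there exists a scattered $\mathbb{F}_q$-linear set of rank $3n$ in $PG(2,q^{2n})$.
   Context: For an $\mathbb{F}_q$-subspace $U$ of $\mathbb{F}_{q^{2n}}^3$ of $\mathbb{F}_q$-dimension $k$, $L_U=\{\langle u\rangle_{\mathbb{F}_{q^{2n}}}: u\in U\setminus\{0\}\}\subseteq PG(2,q^{2n})$ is an $\mathbb{F}_q$-linear set of rank $k$; it is scattered if every point $\langle v\rangle$ of $L_U$ satisfies $\dim_{\mathbb{F}_q}(U\cap\langle v\rangle_{\mathbb{F}_{q^{2n}}})=1$. *)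

theory Defs
  imports "HOL-Analysis.Cartesian_Space" "HOL-Number_Theory.Number_Theory"
begin

text \<open>The inclusion of \<open>F\<^sub>q\<close> in \<open>F\<^bsub>q^(2n)\<^esub>\<close> is rendered by a unital ring homomorphism
  \<open>\<iota>\<close> from a field type \<open>'q\<close> of order \<open>q\<close> to a field type \<open>'a\<close> of order \<open>q^(2n)\<close>, so that the
  library's \<open>subspace\<close> and \<open>dim\<close> apply to \<open>F\<^sub>q\<close>-subspaces of \<open>'a ^ 3\<close>.\<close>

definition field_embedding :: "('q::field \<Rightarrow> 'a::field) \<Rightarrow> bool" where
  "field_embedding \<iota> \<longleftrightarrow>
     \<iota> 1 = 1 \<and> (\<forall>x y. \<iota> (x + y) = \<iota> x + \<iota> y) \<and> (\<forall>x y. \<iota> (x * y) = \<iota> x * \<iota> y)"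

definition sub_scale :: "('q::field \<Rightarrow> 'a::field) \<Rightarrow> 'q \<Rightarrow> 'a ^ 3 \<Rightarrow> 'a ^ 3" where
  "sub_scale \<iota> c v = \<iota> c *s v"

lemma vector_space_sub_scale:
  assumes "field_embedding \<iota>"
  shows "vector_space (sub_scale \<iota>)"
  using assms unfolding field_embedding_def sub_scale_def
  by unfold_locales (simp_all add: vector_add_ldistrib vector_sadd_rdistrib vector_smult_assoc)

text \<open>Points of \<open>PG(2, 'a)\<close> are the one-dimensional \<open>'a\<close>-subspaces of \<open>'a ^ 3\<close>; \<open>vec.span\<close> is the
  span over the large field \<open>'a\<close>.\<close>

definition linear_set :: "('a::field ^ 3) set \<Rightarrow> ('a ^ 3) set set" where
  "linear_set U = {vec.span {u} | u. u \<in> U - {0}}"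

definition scattered_linear_set ::
  "('q::field \<Rightarrow> 'a::field) \<Rightarrow> nat \<Rightarrow> ('a ^ 3) set set \<Rightarrow> bool" where
  "scattered_linear_set \<iota> k L \<longleftrightarrow>
     (\<exists>U. module.subspace (sub_scale \<iota>) U \<and> vector_space.dim (sub_scale \<iota>) U = k \<and>
          L = linear_set U \<and>
          (\<forall>P\<in>L. vector_space.dim (sub_scale \<iota>) (U \<inter> P) = 1))"

end

theory Submission
  imports Defs "HOL-Algebra.Algebraic_Closure_Type"
begin

text \<open>Let \<open>K\<close> be the subfield of order \<open>q^n\<close>, let \<open>\<omega>\<close> be an element outside \<open>K\<close>, and let \<open>f\<close>
  be a map of \<open>K^3\<close> that is semilinear for a generator of the Galois group of \<open>K\<close> over \<open>F\<^sub>q\<close>. The set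
  \<open>U = {f x + \<omega> x | x \<in> K^3}\<close> has rank \<open>3n\<close>. If \<open>(A + B \<omega>) u \<in> U\<close> for a nonzero \<open>u = f x + \<omega> x\<close>, then
  comparing coordinates with respect to \<open>1, \<omega>\<close> and applying \<open>f\<close> yields a relation between \<open>x\<close>, \<open>f x\<close>
  and \<open>f (f x)\<close> in which \<open>f (f x)\<close> has a coefficient that vanishes only if \<open>B = 0\<close>. Hence \<open>U\<close> is
  scattered as soon as \<open>f\<close> has no invariant \<open>K\<close>-subspace of dimension 1 or 2.

  If 3 does not divide \<open>n\<close>, identify \<open>K^3\<close> with the field of order \<open>q^(3n)\<close> and take
  \<open>f z = a z^(q^3)\<close>, where the norm \<open>\<nu>\<close> of \<open>a\<close> over \<open>F\<^bsub>q^3\<^esub>\<close> is not in \<open>F\<^sub>q\<close>: the \<open>n\<close>-th iterate of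
  \<open>f\<close> is multiplication by \<open>\<nu>\<close>, which has degree 3 over \<open>K\<close>. If 3 divides \<open>n\<close>, take
  \<open>f (x, y, z) = (a z^q, x^q, y^q)\<close>, where the norm \<open>\<nu>\<close> of \<open>a\<close> over \<open>F\<^bsub>q^3\<^esub>\<close> is not in \<open>F\<^sub>q\<close>: the
  \<open>n\<close>-th iterate of \<open>f\<close> is diagonal with the three distinct conjugates of \<open>\<nu>\<close> as entries, and \<open>f\<close>
  permutes the coordinate axes cyclically.\<close>

no_notation fps_nth (infixl "$" 75)

section \<open>Fixed fields of power maps and the number of their elements\<close>

definition fixed_field :: "nat \<Rightarrow> 'a::field set" where
  "fixed_field Q = {x. x ^ Q = x}"

lemma fixed_field_iff: "x \<in> fixed_field Q \<longleftrightarrow> x ^ Q = x"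
  by (simp add: fixed_field_def)

lemma power_card_eq_self:
  fixes x :: "'a::{field,finite}"
  shows "x ^ CARD('a) = x"
proof (cases "x = 0")
  case False
  have "bij_betw (\<lambda>y. x * y) (UNIV - {0}) (UNIV - {0})"
    by (rule bij_betw_byWitness[where f' = "\<lambda>y. y / x"]) (use False in \<open>auto simp: image_subset_iff\<close>)
  from prod.reindex_bij_betw[OF this, of "\<lambda>y. y"]
  have "x ^ card (UNIV - {0::'a}) * (\<Prod>y\<in>UNIV - {0}. y) = (\<Prod>y\<in>UNIV - {0::'a}. y)"
    by (simp add: prod.distrib)
  hence "x ^ card (UNIV - {0::'a}) = 1"
    by simp
  moreover have "CARD('a) = Suc (card (UNIV - {0::'a}))"
    by (rule card.remove) simp_all
  ultimately show ?thesis
    by (metis mult.right_neutral power_Suc)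
qed simp

text \<open>Otherwise all \<open>Q\<close> elements of the fixed field are roots of X^(er) - X^e, a
  nonzero polynomial of degree at most \<open>e * r < Q\<close>. Taking for \<open>e\<close> a norm
  exponent produces norms outside F_q.\<close>

lemma ex_power_not_fixed:
  assumes "card (fixed_field Q :: 'a::field set) = Q" and "0 < e" "1 < r" "e * r < Q"
  shows "\<exists>a\<in>fixed_field Q. (a ^ e) ^ r \<noteq> (a ^ e :: 'a)"
proof (rule ccontr)
  assume neg: "\<not> ?thesis"
  define p :: "'a poly" where "p = monom 1 (e * r) - monom 1 e"
  have ne: "e \<noteq> e * r"
    using assms by auto
  have "poly.coeff p (e * r) = 1"
    using ne by (simp add: p_def)
  hence "p \<noteq> 0"
    by auto
  have "Q = card (fixed_field Q :: 'a set)"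
    using assms by simp
  also have "\<dots> \<le> card {x. poly p x = 0}"
    using neg poly_roots_finite[OF \<open>p \<noteq> 0\<close>]
    by (intro card_mono) (auto simp: p_def poly_monom power_mult)
  also have "\<dots> \<le> degree p"
    by (rule card_poly_roots_bound) fact
  also have "degree p \<le> e * r"
    unfolding p_def
    by (rule degree_diff_le) (use assms in \<open>auto intro: order.trans[OF degree_monom_le]\<close>)
  finally show False
    using assms by simp
qed

text \<open>X^Q - X splits into linear factors, and its derivative is the constant -1, so no root is
  repeated.\<close>

lemma card_fixed_field_alg_closed:
  assumes "Factorial_Ring.prime CHAR('a::alg_closed_field)" and "Q = CHAR('a) ^ m" and "0 < m"
  shows "card (fixed_field Q :: 'a set) = Q"
proof -
  define p :: "'a poly" where "p = monom 1 Q - monom 1 1"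
  have "CHAR('a) > 1"
    using assms(1) prime_gt_1_nat by blast
  hence Q: "Q > 1"
    using assms(3) unfolding assms(2) by (rule one_less_power)
  have deg: "degree p = Q"
  proof -
    have "degree (monom 1 Q :: 'a poly) = Q" "degree (monom 1 1 :: 'a poly) = 1"
      by (simp_all add: degree_monom_eq)
    thus ?thesis
      unfolding p_def diff_conv_add_uminus using Q by (subst degree_add_eq_left) simp_all
  qed
  hence "p \<noteq> 0"
    using Q by auto
  have "of_nat Q = (0 :: 'a)"
    using assms by (simp add: of_nat_eq_0_iff_char_dvd)
  hence pderiv: "pderiv p = [:- 1:]"
    by (simp add: p_def pderiv_diff pderiv_monom monom_0)
  obtain A where A: "size A = degree p" "p = smult (lead_coeff p) (\<Prod>x\<in>#A. [:-x, 1:])"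
    using alg_closed_imp_factorization[OF \<open>p \<noteq> 0\<close>] by blast
  have count: "count A x \<le> 1" for x
  proof (rule ccontr)
    assume "\<not> count A x \<le> 1"
    hence "2 \<le> count A x"
      by simp
    hence "replicate_mset 2 x \<subseteq># A"
      by (simp add: count_le_replicate_mset_subset_eq)
    then obtain B where "A = replicate_mset 2 x + B"
      by (metis subset_mset.add_diff_inverse)
    hence "(\<Prod>y\<in>#A. g y) = g x * g x * (\<Prod>y\<in>#B. g y)" for g :: "'a \<Rightarrow> 'a poly"
      by (simp add: numeral_2_eq_2 mult.assoc)
    hence "p = smult (lead_coeff p) ([:-x, 1:] * [:-x, 1:] * (\<Prod>y\<in>#B. [:-y, 1:]))"
      using A(2) by metis
    then obtain r where "p = [:-x, 1:] * [:-x, 1:] * r"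
      by (metis mult_smult_right)
    moreover have "poly (pderiv (l * l * r)) x = 0" if "poly l x = 0" for l
      by (simp add: pderiv_mult that)
    moreover have "poly [:-x, 1:] x = 0"
      by simp
    ultimately have "poly (pderiv p) x = 0"
      by metis
    thus False
      by (simp add: pderiv)
  qed
  have roots: "fixed_field Q = {x. poly p x = 0}"
    by (auto simp: fixed_field_def p_def poly_monom)
  have "set_mset A \<subseteq> {x. poly p x = 0}"
  proof
    fix x assume "x \<in># A"
    then obtain B where "A = add_mset x B"
      by (metis insert_DiffM)
    hence "p = smult (lead_coeff p) ([:-x, 1:] * (\<Prod>x\<in>#B. [:-x, 1:]))"
      using A(2) by simp
    hence "poly p x = lead_coeff p * (poly [:-x, 1:] x * poly (\<Prod>x\<in>#B. [:-x, 1:]) x)"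
      by (metis poly_mult poly_smult)
    thus "x \<in> {x. poly p x = 0}"
      by simp
  qed
  moreover have "card (set_mset A) = size A"
  proof -
    have "count A x = 1" if "x \<in># A" for x
      using count[of x] that by (simp add: le_Suc_eq flip: count_greater_zero_iff)
    thus ?thesis
      by (simp add: size_multiset_overloaded_eq)
  qed
  ultimately have "Q \<le> card {x. poly p x = 0}"
    using A(1) deg poly_roots_finite[OF \<open>p \<noteq> 0\<close>] by (metis card_mono)
  moreover have "card {x. poly p x = 0} \<le> Q"
    using card_poly_roots_bound[OF \<open>p \<noteq> 0\<close>] deg by simp
  ultimately show ?thesis
    unfolding roots by simp
qed

text \<open>Coordinates in a basis; this allows the rank of \<open>U\<close> to be read off from its
  cardinality.\<close>

lemma (in vector_space) card_subspace_eq_power_dim: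
  assumes "subspace S" and "finite S"
  shows "card S = card (UNIV :: 'a set) ^ dim S"
proof -
  obtain B where B: "B \<subseteq> S" "independent B" "S \<subseteq> span B" "card B = dim S"
    by (rule basis_exists)
  have fin: "finite B"
    using B(1) assms(2) finite_subset by blast
  have S: "S = span B"
    using B assms(1) by (simp add: span_subspace)
  define F where "F u = (\<Sum>b\<in>B. scale (u b) b)" for u
  have "bij_betw F (B \<rightarrow>\<^sub>E UNIV) S"
    unfolding bij_betw_def
  proof
    show "inj_on F (B \<rightarrow>\<^sub>E UNIV)"
    proof (rule inj_onI)
      fix u v assume uv: "u \<in> B \<rightarrow>\<^sub>E UNIV" "v \<in> B \<rightarrow>\<^sub>E UNIV" "F u = F v"
      have "(\<Sum>b\<in>B. scale (u b - v b) b) = 0"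
        using uv(3) by (simp add: F_def scale_left_diff_distrib sum_subtractf)
      hence "u b - v b = 0" if "b \<in> B" for b
        using independentD[OF B(2) fin order_refl, of "\<lambda>b. u b - v b"] that by blast
      thus "u = v"
        using uv by (intro PiE_ext[of u B "\<lambda>_. UNIV"]) auto
    qed
    show "F ` (B \<rightarrow>\<^sub>E UNIV) = S"
    proof (intro equalityI subsetI)
      fix x assume "x \<in> F ` (B \<rightarrow>\<^sub>E UNIV)"
      thus "x \<in> S"
        unfolding S F_def by (auto intro: span_sum span_scale span_base)
    next
      fix x assume "x \<in> S"
      then obtain u where "x = F u"
        unfolding S span_finite[OF fin] F_def by blast
      \<comment> \<open>Members of \<open>B \<rightarrow>\<^sub>E UNIV\<close> are
        \<open>undefined\<close> off \<open>B\<close>; resetting \<open>u\<close> there leaves the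
        sum unchanged.\<close>
      hence "x = F (restrict u B)"
        by (simp add: F_def cong: sum.cong)
      thus "x \<in> F ` (B \<rightarrow>\<^sub>E UNIV)"
        by (auto intro!: imageI)
    qed
  qed
  hence "card S = card (B \<rightarrow>\<^sub>E (UNIV :: 'a set))"
    by (simp add: bij_betw_same_card)
  also have "\<dots> = card (UNIV :: 'a set) ^ dim S"
    by (simp add: card_PiE[OF fin] B(4))
  finally show ?thesis .
qed

section \<open>Arithmetic of Frobenius powers\<close>

lemma frobenius_add:
  fixes x y :: "'b::field"
  assumes "Factorial_Ring.prime CHAR('b)" "q = CHAR('b) ^ k"
  shows "(x + y) ^ (q ^ i) = x ^ (q ^ i) + y ^ (q ^ i)"
  by (rule freshmans_dream'[OF assms(1), of _ "k * i"]) (simp add: assms(2) power_mult)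

lemma frobenius_diff:
  fixes x y :: "'b::field"
  assumes "Factorial_Ring.prime CHAR('b)" "q = CHAR('b) ^ k"
  shows "(x - y) ^ (q ^ i) = x ^ (q ^ i) - y ^ (q ^ i)"
  using frobenius_add[OF assms, of "x - y" y i] by (simp add: algebra_simps)

lemma frobenius_eq_iff:
  fixes x y :: "'b::field"
  assumes "Factorial_Ring.prime CHAR('b)" "q = CHAR('b) ^ k"
  shows "x ^ (q ^ i) = y ^ (q ^ i) \<longleftrightarrow> x = y"
  using frobenius_diff[OF assms, of x y i] assms(1) by (auto simp: power_0_left prime_gt_0_nat)

lemma fixed_field_mult: "x \<in> fixed_field Q \<Longrightarrow> y \<in> fixed_field Q \<Longrightarrow> x * y \<in> fixed_field Q"
  by (simp add: fixed_field_iff power_mult_distrib)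

lemma fixed_field_divide: "x \<in> fixed_field Q \<Longrightarrow> y \<in> fixed_field Q \<Longrightarrow> x / y \<in> fixed_field Q"
  by (simp add: fixed_field_iff power_divide)

lemma fixed_field_power: "x \<in> fixed_field Q \<Longrightarrow> x ^ m \<in> fixed_field Q"
  by (metis fixed_field_iff mult.commute power_mult)

lemma power_power_fixed_field: "x \<in> fixed_field (q ^ i) \<Longrightarrow> x ^ (q ^ (i * m)) = x"
  by (induction m) (simp_all add: fixed_field_iff power_add power_mult)

section \<open>Norms down to the field of order q^3\<close>

text \<open>Raising to the power \<open>norm_exponent q m\<close> is the norm from \<open>F\<^bsub>q^(3m)\<^esub>\<close> to \<open>F\<^bsub>q^3\<^esub>\<close>.\<close>

definition norm_exponent :: "nat \<Rightarrow> nat \<Rightarrow> nat" where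
  "norm_exponent q m = (\<Sum>j<m. q ^ (3 * j))"

text \<open>The summand \<open>j = 0\<close> is split off here, while the definition splits off the
  last one; comparing the two gives \<open>norm_fixed\<close>.\<close>

lemma norm_exponent_Suc: "norm_exponent q (Suc m) = 1 + norm_exponent q m * q ^ 3"
  unfolding norm_exponent_def
  by (subst sum.lessThan_Suc_shift) (simp add: sum_distrib_left power_add mult.commute)

text \<open>Each application raises the accumulated factor to the power \<open>q ^ 3\<close> and
  adds one more \<open>b\<close>. On the field of order \<open>q ^ (3 * m)\<close> the m-th iterate
  is thus multiplication by a constant.\<close>

lemma funpow_twisted:
  fixes b :: "'b::field"
  shows "((\<lambda>z. b * z ^ (q ^ 3)) ^^ m) z = b ^ norm_exponent q m * z ^ (q ^ (3 * m))"
proof (induction m)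
  case (Suc m)
  have "z ^ (q ^ (3 * Suc m)) = (z ^ (q ^ (3 * m))) ^ (q ^ 3)"
    by (simp add: add.commute flip: power_mult power_add)
  with Suc show ?case
    by (simp add: norm_exponent_Suc power_mult_distrib power_mult[of b] del: mult_Suc_right)
qed (simp add: norm_exponent_def)

lemma norm_exponent_pos: "0 < m \<Longrightarrow> 0 < norm_exponent q m"
  by (cases m) (simp_all add: norm_exponent_Suc)

text \<open>The exponent is the geometric sum (q^(3m) - 1) / (q^3 - 1). The bound is the degree
  condition of \<open>ex_power_not_fixed\<close> for \<open>r = q\<close>.\<close>

lemma norm_exponent_less:
  assumes "1 < q"
  shows "norm_exponent q m * q < q ^ (3 * m)"
proof (induction m)
  case (Suc m)
  have "2 * 2 * q \<le> q * q * q"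
    using assms by (intro mult_le_mono) auto
  hence "1 + q \<le> q ^ 3"
    unfolding power3_eq_cube using assms by linarith
  have "norm_exponent q (Suc m) * q = norm_exponent q m * q + q ^ (3 * m) * q"
    by (simp add: norm_exponent_def algebra_simps)
  also have "\<dots> < q ^ (3 * m) * (1 + q)"
    using Suc by (simp add: algebra_simps)
  also have "\<dots> \<le> q ^ (3 * m) * q ^ 3"
    by (rule mult_left_mono) (use \<open>1 + q \<le> q ^ 3\<close> in simp_all)
  also have "\<dots> = q ^ (3 * Suc m)"
    by (simp add: mult.commute flip: power_add)
  finally show ?case .
qed (simp add: norm_exponent_def)

lemma norm_fixed:
  fixes a :: "'b::field"
  assumes "a \<in> fixed_field (q ^ (3 * m))" and "0 < q"
  shows "(a ^ norm_exponent q m) ^ (q ^ 3) = a ^ norm_exponent q m"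
proof (cases "a = 0 \<or> m = 0")
  case True
  thus ?thesis
  proof
    assume "a = 0"
    thus ?thesis
      using assms(2) by (simp add: power_0_left)
  qed (simp add: norm_exponent_def)
next
  case False
  have "a * (a ^ norm_exponent q m) ^ (q ^ 3) = a ^ norm_exponent q (Suc m)"
    by (simp add: norm_exponent_Suc power_mult)
  also have "\<dots> = a ^ norm_exponent q m * a ^ (q ^ (3 * m))"
    by (simp add: norm_exponent_def power_add)
  also have "\<dots> = a * a ^ norm_exponent q m"
    using assms by (simp add: fixed_field_iff)
  finally show ?thesis
    using False by simp
qed

lemma ex_norm_not_fixed:
  assumes "card (fixed_field (q ^ (3 * m)) :: 'b::field set) = q ^ (3 * m)" "0 < m" "1 < q"
  shows "\<exists>a\<in>fixed_field (q ^ (3 * m)). (a ^ norm_exponent q m) ^ q \<noteq> (a ^ norm_exponent q m :: 'b)"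
  by (rule ex_power_not_fixed) (use assms norm_exponent_less norm_exponent_pos in auto)

text \<open>The fields of orders q^3 and q^m meet in F_q when 3 and m are coprime: reduce
  \<open>m\<close> modulo 3, and for remainder 2 apply one more q-th power.\<close>

lemma power_fixed_gcd_3:
  fixes z :: "'b::field"
  assumes "z ^ (q ^ 3) = z" "z ^ (q ^ m) = z" "\<not> 3 dvd m"
  shows "z ^ q = z"
proof -
  define k r where "k = m div 3" and "r = m mod 3"
  have "z ^ (q ^ (3 * k)) = z"
    by (rule power_power_fixed_field) (simp add: fixed_field_iff assms)
  moreover have "m = 3 * k + r"
    by (simp add: k_def r_def)
  ultimately have r: "z ^ (q ^ r) = z"
    using assms(2) by (simp add: power_add power_mult)
  have "r = 1 \<or> r = 2"
    using assms(3) unfolding r_def by presburger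
  thus ?thesis
  proof
    assume "r = 2"
    hence "z ^ q = (z ^ (q ^ 2)) ^ q"
      using r by simp
    also have "\<dots> = z ^ (q ^ 3)"
      by (simp add: power2_eq_square power3_eq_cube flip: power_mult)
    finally show ?thesis
      using assms by simp
  qed (use r in simp)
qed

section \<open>The subfields K and F_q, and coordinates over K\<close>

locale scattered_construction =
  fixes n q :: nat and \<iota> :: "'q::{field,finite} \<Rightarrow> 'a::{field,finite}"
  assumes n_pos: "0 < n" and q_def: "CARD('q) = q" and card_a: "CARD('a) = q ^ (2 * n)"
    and primepow_q: "primepow q" and emb: "field_embedding \<iota>"
begin

abbreviation K :: "'a set" where "K \<equiv> fixed_field (q ^ n)"

abbreviation V :: "('a ^ 3) set" where "V \<equiv> {v. \<forall>j. v $ j \<in> K}"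

lemma prime_char: "Factorial_Ring.prime CHAR('a)"
  using finite_imp_CHAR_pos[where ?'a = 'a] prime_CHAR_semidom[where ?'a = 'a] by simp

lemma q_gt_1: "1 < q"
  using primepow_q primepow_gt_Suc_0 by fastforce

lemma q_power_char: obtains k where "0 < k" "q = CHAR('a) ^ k"
proof -
  obtain p k where pk: "Factorial_Ring.prime p" "0 < k" "q = p ^ k"
    using primepow_q by (auto simp: primepow_def)
  have "CHAR('a) dvd p ^ (k * (2 * n))"
    using CHAR_dvd_CARD[where ?'a = 'a] by (simp add: card_a pk(3) power_mult)
  hence "CHAR('a) = p"
    using prime_char pk(1) by (metis prime_dvd_power primes_dvd_imp_eq)
  thus thesis
    using that pk by blast
qed

lemma frob_add: "(x + y :: 'a) ^ (q ^ i) = x ^ (q ^ i) + y ^ (q ^ i)"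
  using q_power_char frobenius_add[OF prime_char] by metis

lemma frob_diff: "(x - y :: 'a) ^ (q ^ i) = x ^ (q ^ i) - y ^ (q ^ i)"
  using q_power_char frobenius_diff[OF prime_char] by metis

lemma frob_eq_iff: "(x :: 'a) ^ (q ^ i) = y ^ (q ^ i) \<longleftrightarrow> x = y"
  using q_power_char frobenius_eq_iff[OF prime_char] by metis

text \<open>The fields of orders q^3 and q^(3n) need not lie in \<open>'a\<close>; they are realized
  inside its algebraic closure, so Frobenius is needed there too.\<close>

lemma frob_add_ac: "(x + y :: 'a alg_closure) ^ (q ^ i) = x ^ (q ^ i) + y ^ (q ^ i)"
  using q_power_char frobenius_add[where ?'b = "'a alg_closure"] prime_char
  by (metis CHAR_alg_closure)

lemma frob_eq_iff_ac: "(x :: 'a alg_closure) ^ (q ^ i) = y ^ (q ^ i) \<longleftrightarrow> x = y"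
  using q_power_char frobenius_eq_iff[where ?'b = "'a alg_closure"] prime_char
  by (metis CHAR_alg_closure)

lemma card_fixed_field_ac:
  assumes "0 < i"
  shows "card (fixed_field (q ^ i) :: 'a alg_closure set) = q ^ i"
proof -
  obtain k where k: "0 < k" "q = CHAR('a) ^ k"
    by (rule q_power_char)
  show ?thesis
    by (rule card_fixed_field_alg_closed[of _ "k * i"])
      (use k assms prime_char in \<open>simp_all add: power_mult\<close>)
qed

lemma finite_fixed_field_ac: "0 < i \<Longrightarrow> finite (fixed_field (q ^ i) :: 'a alg_closure set)"
  by (rule card_ge_0_finite) (use q_gt_1 in \<open>simp add: card_fixed_field_ac\<close>)

lemma to_ac_fixed_field_iff: "to_ac (x :: 'a) \<in> fixed_field Q \<longleftrightarrow> x \<in> fixed_field Q"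
  by (simp add: fixed_field_iff flip: to_ac_power)

lemma range_to_ac: "range (to_ac :: 'a \<Rightarrow> _) = fixed_field (q ^ (2 * n))"
proof (rule card_subset_eq)
  show "range (to_ac :: 'a \<Rightarrow> _) \<subseteq> fixed_field (q ^ (2 * n))"
    using power_card_eq_self[where ?'a = 'a]
    by (auto simp: fixed_field_iff card_a simp flip: to_ac_power)
  show "card (range (to_ac :: 'a \<Rightarrow> _)) = card (fixed_field (q ^ (2 * n)) :: 'a alg_closure set)"
    using n_pos by (simp add: card_fixed_field_ac card_image inj_to_ac card_a)
qed (use n_pos in \<open>auto intro: finite_fixed_field_ac\<close>)

text \<open>An element fixed by the power \<open>q ^ n\<close> is fixed by its square
  \<open>q ^ (2 * n)\<close>, hence already comes from \<open>'a\<close>. This transfers the count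
  of the fixed field from the closure to \<open>K\<close>.\<close>

lemma to_ac_image_K: "to_ac ` K = (fixed_field (q ^ n) :: 'a alg_closure set)"
proof (intro equalityI subsetI)
  fix z :: "'a alg_closure" assume z: "z \<in> fixed_field (q ^ n)"
  hence "z \<in> fixed_field (q ^ (2 * n))"
    using power_power_fixed_field[OF z, of 2] by (simp add: fixed_field_iff mult.commute)
  thus "z \<in> to_ac ` K"
    using z by (auto simp: to_ac_fixed_field_iff simp flip: range_to_ac)
qed (auto simp: to_ac_fixed_field_iff)

lemma card_K: "card K = q ^ n"
  using card_image[OF inj_on_subset[OF inj_to_ac subset_UNIV], of K] n_pos
  by (simp add: to_ac_image_K card_fixed_field_ac)

lemma \<iota>_simps: "\<iota> 1 = 1" "\<iota> (x + y) = \<iota> x + \<iota> y" "\<iota> (x * y) = \<iota> x * \<iota> y"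
  using emb by (auto simp: field_embedding_def)

lemma inj_\<iota>: "inj \<iota>"
proof (rule injI)
  fix x y assume eq: "\<iota> x = \<iota> y"
  have "\<iota> ((x - y) + y) = \<iota> x"
    by simp
  hence "\<iota> (x - y) = 0"
    using eq by (simp only: \<iota>_simps) simp
  hence "\<iota> ((x - y) * inverse (x - y)) = 0"
    by (simp only: \<iota>_simps) simp
  thus "x = y"
    using \<iota>_simps(1) by (metis right_inverse eq_iff_diff_eq_0 zero_neq_one)
qed

text \<open>Inclusion plus counting. Membership in F_q becomes the equation
  \<open>c ^ q = c\<close>.\<close>

lemma range_\<iota>: "range \<iota> = fixed_field q"
proof (rule card_seteq)
  have pow: "\<iota> (x ^ m) = \<iota> x ^ m" for x m
    by (induction m) (simp_all add: \<iota>_simps)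
  show "range \<iota> \<subseteq> fixed_field q"
    using power_card_eq_self[where ?'a = 'q] by (auto simp: fixed_field_iff q_def simp flip: pow)
  have "card (fixed_field q :: 'a set) = card (to_ac ` (fixed_field q :: 'a set))"
    by (rule card_image[symmetric]) (rule inj_on_subset[OF inj_to_ac subset_UNIV])
  also have "\<dots> \<le> card (fixed_field (q ^ 1) :: 'a alg_closure set)"
    by (rule card_mono) (auto simp: to_ac_fixed_field_iff intro: finite_fixed_field_ac[of 1, simplified])
  also have "\<dots> = q"
    by (subst card_fixed_field_ac) simp_all
  finally show "card (fixed_field q :: 'a set) \<le> card (range \<iota>)"
    by (simp add: card_image inj_\<iota> q_def)
qed simp

lemma fixed_field_q_subset: "x \<in> fixed_field q \<Longrightarrow> x \<in> fixed_field (q ^ i)"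
  using power_power_fixed_field[of x q 1 i] by (simp add: fixed_field_iff)

lemma K_0: "0 \<in> K" and K_1: "1 \<in> K"
  using q_gt_1 by (simp_all add: fixed_field_iff)

lemma K_add: "x \<in> K \<Longrightarrow> y \<in> K \<Longrightarrow> x + y \<in> K"
  by (simp add: fixed_field_iff frob_add)

lemma K_diff: "x \<in> K \<Longrightarrow> y \<in> K \<Longrightarrow> x - y \<in> K"
  by (simp add: fixed_field_iff frob_diff)

lemma K_minus: "x \<in> K \<Longrightarrow> - x \<in> K"
  using K_diff[OF K_0, of x] by simp

lemmas K_closed = K_0 K_1 K_add K_diff K_minus fixed_field_mult[of _ "q ^ n"]
  fixed_field_divide[of _ "q ^ n"] fixed_field_power[of _ "q ^ n"]

lemma card_V: "card V = q ^ (3 * n)"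
proof -
  have "V = vec_lambda ` (UNIV \<rightarrow>\<^sub>E K)"
  proof (intro equalityI subsetI)
    fix v assume "v \<in> V"
    hence "vec_nth v \<in> UNIV \<rightarrow>\<^sub>E K"
      by auto
    thus "v \<in> vec_lambda ` (UNIV \<rightarrow>\<^sub>E K)"
      by (metis image_eqI vec_nth_inverse)
  qed auto
  hence "card V = card ((UNIV :: 3 set) \<rightarrow>\<^sub>E K)"
    by (simp add: card_image inj_on_def vec_lambda_inject)
  thus ?thesis
    by (simp add: card_PiE card_K mult.commute flip: power_mult)
qed

lemma V_add: "x \<in> V \<Longrightarrow> y \<in> V \<Longrightarrow> x + y \<in> V"
  by (auto intro: K_closed)

lemma V_scale: "c \<in> K \<Longrightarrow> x \<in> V \<Longrightarrow> c *s x \<in> V"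
  by (auto intro: K_closed)

lemma K_coordinates_unique:
  assumes "\<omega> \<notin> K" "a \<in> K" "b \<in> K" "c \<in> K" "d \<in> K" "a + \<omega> * b = c + \<omega> * d"
  shows "a = c \<and> b = d"
proof -
  have "b = d"
  proof (rule ccontr)
    assume "b \<noteq> d"
    hence "\<omega> = (c - a) / (b - d)"
      using assms(6) by (simp add: field_simps)
    thus False
      using assms by (auto intro: K_closed)
  qed
  thus ?thesis
    using assms(6) by simp
qed

text \<open>Any element outside \<open>K\<close> works: the pairs over \<open>K\<close> give
  distinct values, and there are as many pairs as elements of \<open>'a\<close>.\<close>

lemma K_coordinates_exist:
  obtains \<omega> where "\<omega> \<notin> K" "\<And>x. \<exists>a\<in>K. \<exists>b\<in>K. x = a + b * \<omega>"
proof -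
  have "card K < CARD('a)"
    unfolding card_K card_a using q_gt_1 n_pos by simp
  then obtain \<omega> where \<omega>: "\<omega> \<notin> K"
    by (metis UNIV_I finite less_irrefl subsetI top.extremum_uniqueI)
  define g where "g = (\<lambda>(a, b). a + b * \<omega>)"
  have "inj_on g (K \<times> K)"
    using K_coordinates_unique[OF \<omega>] by (auto simp: inj_on_def g_def mult.commute)
  hence "card (g ` (K \<times> K)) = CARD('a)"
    by (simp add: card_image card_cartesian_product card_K card_a power_add mult_2)
  hence "g ` (K \<times> K) = UNIV"
    by (simp add: card_eq_UNIV_imp_eq_UNIV)
  have "\<exists>a\<in>K. \<exists>b\<in>K. x = a + b * \<omega>" for x
  proof -
    have "x \<in> g ` (K \<times> K)"
      unfolding \<open>g ` (K \<times> K) = UNIV\<close> by (rule UNIV_I)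
    thus ?thesis
      unfolding g_def by auto
  qed
  thus thesis
    using that \<omega> by blast
qed

section \<open>The criterion for scatteredness\<close>

text \<open>The twist \<open>q ^ i\<close> is left open because the two cases use
  \<open>i = 3\<close> and \<open>i = 1\<close>. Assumption \<open>fix_q\<close> makes F_q the fixed
  field of the twist on \<open>K\<close>; \<open>indep\<close> is the absence of small invariant
  subspaces, in the form in which it is applied.\<close>

lemma scattered_of_semilinear:
  fixes f :: "'a ^ 3 \<Rightarrow> 'a ^ 3"
  assumes fV: "\<And>x. x \<in> V \<Longrightarrow> f x \<in> V"
    and f_add: "\<And>x y. x \<in> V \<Longrightarrow> y \<in> V \<Longrightarrow> f (x + y) = f x + f y"
    and f_scale: "\<And>c x. c \<in> K \<Longrightarrow> x \<in> V \<Longrightarrow> f (c *s x) = c ^ (q ^ i) *s f x"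
    and fix_q: "\<And>c. c \<in> K \<Longrightarrow> c ^ (q ^ i) = c \<Longrightarrow> c ^ q = c"
    and indep: "\<And>x a b. x \<in> V \<Longrightarrow> x \<noteq> 0 \<Longrightarrow> a \<in> K \<Longrightarrow> b \<in> K \<Longrightarrow> f (f x) \<noteq> a *s x + b *s f x"
  shows "\<exists>L. scattered_linear_set \<iota> (3 * n) L"
proof -
  interpret vs: vector_space "sub_scale \<iota>"
    by (rule vector_space_sub_scale) (rule emb)
  obtain \<omega> where \<omega>: "\<omega> \<notin> K" and rep: "\<And>x. \<exists>a\<in>K. \<exists>b\<in>K. x = a + b * \<omega>"
    using K_coordinates_exist by metis
  have uniqV: "x = x' \<and> y = y'"
    if "x \<in> V" "y \<in> V" "x' \<in> V" "y' \<in> V" "x + \<omega> *s y = x' + \<omega> *s y'" for x y x' y'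
  proof -
    have "x $ j + \<omega> * y $ j = x' $ j + \<omega> * y' $ j" for j
      using arg_cong[OF that(5), of "\<lambda>v. v $ j"] by simp
    hence "x $ j = x' $ j \<and> y $ j = y' $ j" for j
      using that(1-4) K_coordinates_unique[OF \<omega>] by blast
    thus ?thesis
      by (simp add: vec_eq_iff)
  qed
  \<comment> \<open>Scalars from F_q are untouched by the twist, so \<open>f\<close> and
    \<open>g\<close> are F_q-linear.\<close>
  have \<iota>K: "\<iota> c \<in> K" "\<iota> c ^ (q ^ i) = \<iota> c" for c
    using rangeI[of \<iota> c] fixed_field_q_subset[of "\<iota> c"] unfolding range_\<iota>
    by (simp_all only: fixed_field_iff)
  have V0: "0 \<in> V"
    using K_0 by simp
  have f0: "f 0 = 0"
    using f_add[OF V0 V0] by simp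
  \<comment> \<open>If \<open>f x = 0\<close> then \<open>f (f x) = 0\<close>, contrary to
    \<open>indep\<close> with both coefficients 0.\<close>
  have f_nz: "f x \<noteq> 0" if "x \<in> V" "x \<noteq> 0" for x
    using indep[OF that K_0 K_0] f0 by (metis add.left_neutral vector_smult_lzero)
  define g where "g x = f x + \<omega> *s x" for x
  have g_inj: "inj_on g V"
    unfolding g_def by (rule inj_onI) (use uniqV fV in blast)
  define U where "U = g ` V"
  have sub: "vs.subspace U"
  proof (rule vs.subspaceI)
    show "0 \<in> U"
      unfolding U_def by (rule image_eqI[of _ _ 0]) (use V0 f0 in \<open>simp_all add: g_def\<close>)
  next
    fix u v assume "u \<in> U" "v \<in> U"
    then obtain x y where "x \<in> V" "u = g x" "y \<in> V" "v = g y"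
      unfolding U_def by blast
    thus "u + v \<in> U"
      unfolding U_def
      by (intro image_eqI[of _ _ "x + y"] V_add) (simp_all add: g_def f_add vector_add_ldistrib)
  next
    fix c u assume "u \<in> U"
    then obtain x where x: "x \<in> V" "u = g x"
      unfolding U_def by blast
    show "sub_scale \<iota> c u \<in> U"
      unfolding U_def sub_scale_def
      by (intro image_eqI[of _ _ "\<iota> c *s x"] V_scale)
        (use x \<iota>K in \<open>simp_all add: g_def f_scale vector_add_ldistrib vector_smult_assoc mult.commute\<close>)
  qed
  have "card U = q ^ (3 * n)"
    unfolding U_def by (simp add: card_image g_inj card_V)
  hence "q ^ vs.dim U = q ^ (3 * n)"
    using vs.card_subspace_eq_power_dim[OF sub] by (simp add: q_def)
  hence dimU: "vs.dim U = 3 * n"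
    using q_gt_1 by simp
  \<comment> \<open>Scatteredness in terms of scalars: only elements of F_q carry a nonzero vector
    of \<open>U\<close> back into \<open>U\<close>.\<close>
  have key: "l \<in> range \<iota>" if x: "x \<in> V" "x \<noteq> 0" and y: "y \<in> V" "l *s g x = g y" for x y l
  proof -
    obtain A B where AB: "A \<in> K" "B \<in> K" "l = A + B * \<omega>"
      using rep by blast
    \<comment> \<open>The quadratic equation of \<open>\<omega>\<close> over \<open>K\<close>, used
      to rewrite the product in coordinates.\<close>
    obtain s t where st: "s \<in> K" "t \<in> K" "\<omega> * \<omega> = s + t * \<omega>"
      using rep by blast
    have "l *s g x = (A *s f x + (s * B) *s x) + \<omega> *s ((A + t * B) *s x + B *s f x)"
    proof (subst vec_eq_iff, intro allI)
      fix j
      have "(A + B * \<omega>) * (f x $ j + \<omega> * x $ j)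
          = A * f x $ j + (\<omega> * \<omega>) * B * x $ j + \<omega> * (A * x $ j + B * f x $ j)"
        by (simp add: algebra_simps)
      thus "(l *s g x) $ j
          = ((A *s f x + (s * B) *s x) + \<omega> *s ((A + t * B) *s x + B *s f x)) $ j"
        unfolding st(3) by (simp add: g_def AB(3) algebra_simps)
    qed
    hence "(A *s f x + (s * B) *s x) + \<omega> *s ((A + t * B) *s x + B *s f x) = f y + \<omega> *s y"
      using y(2) by (simp add: g_def)
    moreover have "A *s f x + (s * B) *s x \<in> V" "(A + t * B) *s x + B *s f x \<in> V"
      using AB st x fV by (intro V_add V_scale K_closed; simp)+
    ultimately have "A *s f x + (s * B) *s x = f y \<and> (A + t * B) *s x + B *s f x = y"
      using fV[OF y(1)] y(1) by (intro uniqV)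
    hence eqs: "f y = A *s f x + (s * B) *s x" "y = (A + t * B) *s x + B *s f x"
      by simp_all
    have "A + t * B \<in> K"
      using AB st by (intro K_closed)
    \<comment> \<open>Applying \<open>f\<close> to the formula for \<open>y\<close> gives a second
      expression for \<open>f y\<close>; equating both isolates \<open>f (f x)\<close>.\<close>
    hence "f y = (A + t * B) ^ (q ^ i) *s f x + B ^ (q ^ i) *s f (f x)"
      unfolding eqs(2) using AB x fV by (simp add: f_add f_scale V_scale del: mem_Collect_eq)
    hence rel: "B ^ (q ^ i) *s f (f x) = (s * B) *s x + (A - (A + t * B) ^ (q ^ i)) *s f x"
      unfolding eqs(1) by (simp add: vec.scale_left_diff_distrib algebra_simps)
    have "B = 0"
    proof (rule ccontr)
      assume "B \<noteq> 0"
      define c where "c = B ^ (q ^ i)"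
      have c: "c \<noteq> 0" "c \<in> K"
        using \<open>B \<noteq> 0\<close> AB(2) by (auto simp: c_def intro: K_closed)
      have "f (f x) = (1 / c) *s (c *s f (f x))"
        using c by (simp add: vector_smult_assoc)
      also have "\<dots> = (s * B / c) *s x + ((A - (A + t * B) ^ (q ^ i)) / c) *s f x"
        unfolding c_def rel by (simp add: vector_add_ldistrib vector_smult_assoc)
      finally show False
        using indep[OF x, of "s * B / c" "(A - (A + t * B) ^ (q ^ i)) / c"] c AB st
        by (simp add: K_closed)
    qed
    \<comment> \<open>With \<open>B = 0\<close>, the relation \<open>rel\<close> only says that the
      twist fixes \<open>A\<close>.\<close>
    hence "A ^ (q ^ i) *s f x = A *s f x"
      using rel q_gt_1 by (auto simp: power_0_left)
    hence "A ^ (q ^ i) = A"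
      using f_nz[OF x] by simp
    hence "A ^ q = A"
      using fix_q AB(1) by blast
    thus ?thesis
      using \<open>B = 0\<close> by (simp add: AB(3) range_\<iota> fixed_field_iff)
  qed
  have "vs.dim (U \<inter> P) = 1" if P: "P \<in> linear_set U" for P
  proof -
    obtain u where u: "u \<in> U" "u \<noteq> 0" "P = vec.span {u}"
      using P by (auto simp: linear_set_def)
    then obtain x where x: "x \<in> V" "u = g x"
      unfolding U_def by blast
    have "x \<noteq> 0"
      using u(2) x(2) f0 by (auto simp: g_def)
    have "U \<inter> P = vs.span {u}"
    proof (intro equalityI subsetI)
      fix w assume w: "w \<in> U \<inter> P"
      then obtain l where l: "w = l *s u"
        unfolding u(3) by (auto simp: vec.span_singleton)
      moreover obtain y where "y \<in> V" "w = g y"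
        using w unfolding U_def by blast
      ultimately have "l \<in> range \<iota>"
        using key[OF x(1) \<open>x \<noteq> 0\<close>] x(2) by metis
      thus "w \<in> vs.span {u}"
        unfolding vs.span_singleton by (auto simp: l sub_scale_def)
    next
      fix w assume "w \<in> vs.span {u}"
      then obtain c where c: "w = sub_scale \<iota> c u"
        by (auto simp: vs.span_singleton)
      show "w \<in> U \<inter> P"
        unfolding c u(3) using vs.subspace_scale[OF sub u(1)]
        by (auto simp: vec.span_singleton sub_scale_def)
    qed
    hence "vs.dim (U \<inter> P) = card {u}"
      using u(2) by (metis vs.dim_span vs.dim_eq_card_independent vs.independent_insert vs.independent_empty vs.span_empty empty_iff singletonD)
    thus ?thesis
      by simp
  qed
  thus ?thesis
    unfolding scattered_linear_set_def using sub dimU by blast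
qed

section \<open>The case where 3 does not divide n\<close>

text \<open>Since 3 does not divide n, \<open>\<theta>\<close> has three distinct conjugates over
  \<open>K\<close>. A polynomial over \<open>K\<close> of degree at most 2 vanishing at one of them
  vanishes at all three, so it is zero.\<close>

lemma cubic_independent:
  fixes \<theta> :: "'a alg_closure"
  assumes "\<not> 3 dvd n" and \<theta>: "\<theta> ^ (q ^ 3) = \<theta>" "\<theta> ^ q \<noteq> \<theta>"
    and abc: "a \<in> K" "b \<in> K" "c \<in> K" "to_ac a + to_ac b * \<theta> + to_ac c * \<theta> ^ 2 = 0"
  shows "a = 0 \<and> b = 0 \<and> c = 0"
proof -
  define \<theta>' where "\<theta>' = \<theta> ^ (q ^ n)"
  define \<theta>'' where "\<theta>'' = \<theta>' ^ (q ^ n)"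
  have "\<theta>'' = \<theta> ^ (q ^ (2 * n))"
    by (simp add: \<theta>''_def \<theta>'_def mult_2 flip: power_mult power_add)
  moreover have "\<not> 3 dvd 2 * n"
    using assms(1) by presburger
  ultimately have "\<theta>'' \<noteq> \<theta>"
    using power_fixed_gcd_3[OF \<theta>(1)] \<theta>(2) by auto
  have "\<theta>' \<noteq> \<theta>"
    using power_fixed_gcd_3[OF \<theta>(1)] \<theta>(2) assms(1) by (auto simp: \<theta>'_def)
  hence "\<theta>'' \<noteq> \<theta>'"
    unfolding \<theta>''_def by (metis \<theta>'_def frob_eq_iff_ac)
  have conj: "to_ac a + to_ac b * z ^ (q ^ n) + to_ac c * (z ^ (q ^ n)) ^ 2 = 0"
    if "to_ac a + to_ac b * z + to_ac c * z ^ 2 = 0" for z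
  proof -
    have "0 = (to_ac a + to_ac b * z + to_ac c * z ^ 2) ^ (q ^ n)"
      using that q_gt_1 by simp
    also have "\<dots> = to_ac (a ^ (q ^ n)) + to_ac (b ^ (q ^ n)) * z ^ (q ^ n)
        + to_ac (c ^ (q ^ n)) * (z ^ (q ^ n)) ^ 2"
      by (simp add: frob_add_ac power_mult_distrib power2_eq_square)
    finally show ?thesis
      using abc(1-3) unfolding fixed_field_iff by metis
  qed
  have e': "to_ac a + to_ac b * \<theta>' + to_ac c * \<theta>' ^ 2 = 0"
    unfolding \<theta>'_def by (rule conj) (rule abc(4))
  have e'': "to_ac a + to_ac b * \<theta>'' + to_ac c * \<theta>'' ^ 2 = 0"
    unfolding \<theta>''_def by (rule conj) (rule e')
  \<comment> \<open>Divided difference at \<open>z\<close> and \<open>\<theta>\<close>; subtracting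
    two of these isolates \<open>c\<close>.\<close>
  have slope: "to_ac b + to_ac c * (z + \<theta>) = 0"
    if "to_ac a + to_ac b * z + to_ac c * z ^ 2 = 0" "z \<noteq> \<theta>" for z
  proof -
    have "(z - \<theta>) * (to_ac b + to_ac c * (z + \<theta>))
        = (to_ac a + to_ac b * z + to_ac c * z ^ 2) - (to_ac a + to_ac b * \<theta> + to_ac c * \<theta> ^ 2)"
      by (simp add: algebra_simps power2_eq_square)
    thus ?thesis
      using that abc(4) by simp
  qed
  have s: "to_ac b + to_ac c * (\<theta>' + \<theta>) = 0" "to_ac b + to_ac c * (\<theta>'' + \<theta>) = 0"
    using slope e' e'' \<open>\<theta>' \<noteq> \<theta>\<close> \<open>\<theta>'' \<noteq> \<theta>\<close> by blast+
  have "to_ac c * (\<theta>'' - \<theta>') = (to_ac b + to_ac c * (\<theta>'' + \<theta>)) - (to_ac b + to_ac c * (\<theta>' + \<theta>))"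
    by (simp add: algebra_simps)
  hence "c = 0"
    using s \<open>\<theta>'' \<noteq> \<theta>'\<close> by simp
  moreover from this have "b = 0"
    using s(1) by simp
  ultimately show ?thesis
    using abc(4) by simp
qed

text \<open>A relation would make the \<open>K\<close>-span \<open>W\<close> of \<open>y\<close> and
  \<open>F y\<close> invariant under \<open>F\<close>, hence under its n-th iterate, multiplication
  by \<open>\<nu>\<close>. Then \<open>y\<close>, \<open>\<nu> * y\<close> and
  \<open>\<nu> * (\<nu> * y)\<close> lie in a space of dimension at most 2, although
  \<open>\<nu>\<close> has degree 3 over \<open>K\<close>.\<close>

lemma twisted_cubic_irreducible:
  fixes a y :: "'a alg_closure"
  assumes "\<not> 3 dvd n"
    and a: "a \<in> fixed_field (q ^ (3 * n))" "(a ^ norm_exponent q n) ^ q \<noteq> a ^ norm_exponent q n"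
    and y: "y \<in> fixed_field (q ^ (3 * n))" "y \<noteq> 0"
    and cd: "c \<in> K" "d \<in> K"
  defines "F \<equiv> (\<lambda>z. a * z ^ (q ^ 3))"
  shows "F (F y) \<noteq> to_ac c * y + to_ac d * F y"
proof
  assume FF: "F (F y) = to_ac c * y + to_ac d * F y"
  define W where "W = {to_ac s * y + to_ac t * F y |s t. s \<in> K \<and> t \<in> K}"
  have F_W: "F w \<in> W" if w: "w \<in> W" for w
  proof -
    obtain s t where st: "s \<in> K" "t \<in> K" "w = to_ac s * y + to_ac t * F y"
      using w by (auto simp: W_def)
    have "F w = to_ac (s ^ (q ^ 3)) * F y + to_ac (t ^ (q ^ 3)) * F (F y)"
      by (simp add: st(3) F_def frob_add_ac power_mult_distrib algebra_simps)
    also have "\<dots> = to_ac (t ^ (q ^ 3) * c) * y + to_ac (s ^ (q ^ 3) + t ^ (q ^ 3) * d) * F y"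
      unfolding FF by (simp add: algebra_simps)
    finally show ?thesis
      unfolding W_def using st cd by (blast intro: K_closed)
  qed
  have funpow_W: "(F ^^ m) w \<in> W" if "w \<in> W" for m w
    by (induction m) (simp_all add: F_W that)
  define \<nu> where "\<nu> = a ^ norm_exponent q n"
  have F_n: "(F ^^ n) z = \<nu> * z" if "z \<in> fixed_field (q ^ (3 * n))" for z
    unfolding F_def funpow_twisted using that by (simp add: \<nu>_def fixed_field_iff)
  have \<nu>: "\<nu> \<in> fixed_field (q ^ (3 * n))"
    unfolding \<nu>_def by (rule fixed_field_power) (rule a(1))
  have \<nu>3: "\<nu> ^ (q ^ 3) = \<nu>" "\<nu> ^ q \<noteq> \<nu>"
    unfolding \<nu>_def using norm_fixed[OF a(1)] a(2) q_gt_1 by simp_all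
  have "y \<in> W"
    unfolding W_def using K_0 K_1 by (intro CollectI exI[of _ 1] exI[of _ 0]) simp
  hence "\<nu> * y \<in> W"
    using funpow_W F_n y by metis
  hence "\<nu> * (\<nu> * y) \<in> W"
    using funpow_W F_n y \<nu> fixed_field_mult by metis
  obtain s t where st: "s \<in> K" "t \<in> K" "\<nu> * y = to_ac s * y + to_ac t * F y"
    using \<open>\<nu> * y \<in> W\<close> by (auto simp: W_def)
  obtain s' t' where st': "s' \<in> K" "t' \<in> K" "\<nu> * (\<nu> * y) = to_ac s' * y + to_ac t' * F y"
    using \<open>\<nu> * (\<nu> * y) \<in> W\<close> by (auto simp: W_def)
  \<comment> \<open>The coefficients arise by eliminating \<open>F y\<close> from the two
    representations.\<close>
  have "(to_ac (t' * s - t * s') + to_ac (- t') * \<nu> + to_ac t * \<nu> ^ 2) * y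
      = to_ac (t' * s - t * s') * y - to_ac t' * (\<nu> * y) + to_ac t * (\<nu> * (\<nu> * y))"
    by (simp add: algebra_simps power2_eq_square)
  also have "\<dots> = 0"
    unfolding st'(3) unfolding st(3) by (simp add: algebra_simps)
  finally have "to_ac (t' * s - t * s') + to_ac (- t') * \<nu> + to_ac t * \<nu> ^ 2 = 0"
    using y(2) by simp
  moreover have "t' * s - t * s' \<in> K" "- t' \<in> K"
    using st st' by (simp_all add: K_closed)
  ultimately have "t = 0"
    using cubic_independent[OF assms(1) \<nu>3] st(2) by blast
  hence "\<nu> = to_ac s"
    using st(3) y(2) by simp
  hence "to_ac (- s) + to_ac 1 * \<nu> + to_ac 0 * \<nu> ^ 2 = 0"
    by simp
  hence "(1 :: 'a) = 0"
    using cubic_independent[OF assms(1) \<nu>3, of "- s" 1 0] st(1) K_closed(1-2,5) by blast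
  thus False
    by simp
qed

lemma scattered_if_not_3_dvd:
  assumes n3: "\<not> 3 dvd n"
  shows "\<exists>L. scattered_linear_set \<iota> (3 * n) L"
proof -
  let ?L = "fixed_field (q ^ (3 * n)) :: 'a alg_closure set"
  \<comment> \<open>For \<open>m = 1\<close> the norm exponent is 1, so this yields an element of
    the cubic extension outside F_q.\<close>
  obtain \<theta> :: "'a alg_closure" where "\<theta> \<in> fixed_field (q ^ (3 * 1))"
    and "(\<theta> ^ norm_exponent q 1) ^ q \<noteq> \<theta> ^ norm_exponent q 1"
    using ex_norm_not_fixed[OF card_fixed_field_ac[of "3 * 1"]] q_gt_1 by auto
  hence \<theta>: "\<theta> ^ (q ^ 3) = \<theta>" "\<theta> ^ q \<noteq> \<theta>"
    by (simp_all add: fixed_field_iff norm_exponent_def)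
  obtain a where a: "a \<in> ?L" "(a ^ norm_exponent q n) ^ q \<noteq> a ^ norm_exponent q n"
    using ex_norm_not_fixed[OF card_fixed_field_ac[of "3 * n"] n_pos q_gt_1] n_pos by auto
  \<comment> \<open>Identifies \<open>V\<close> with the field of order q^(3n) through the basis 1,
    \<open>\<theta>\<close>, \<open>\<theta> ^ 2\<close>; surjectivity follows by counting.\<close>
  define \<phi> where "\<phi> v = to_ac (v $ 1) + to_ac (v $ 2) * \<theta> + to_ac (v $ 3) * \<theta> ^ 2" for v :: "'a ^ 3"
  have \<phi>_add: "\<phi> (v + w) = \<phi> v + \<phi> w" and \<phi>_diff: "\<phi> (v - w) = \<phi> v - \<phi> w"
    and \<phi>_scale: "\<phi> (c *s v) = to_ac c * \<phi> v" for v w c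
    by (simp_all add: \<phi>_def algebra_simps)
  have \<phi>_0: "v = 0" if "v \<in> V" "\<phi> v = 0" for v
    using cubic_independent[OF n3 \<theta>, of "v $ 1" "v $ 2" "v $ 3"] that
    by (auto simp: \<phi>_def vec_eq_iff forall_3)
  have inj: "inj_on \<phi> V"
  proof (rule inj_onI)
    fix v w assume "v \<in> V" "w \<in> V" "\<phi> v = \<phi> w"
    hence "v - w = 0"
      by (intro \<phi>_0) (auto simp: \<phi>_diff intro: K_closed)
    thus "v = w"
      by simp
  qed
  have \<phi>_L: "\<phi> v \<in> ?L" if "v \<in> V" for v
  proof -
    have K3: "x ^ (q ^ (3 * n)) = x" if "x \<in> K" for x
      using power_power_fixed_field[OF that, of 3] by (simp add: mult.commute)
    have "\<theta> ^ (q ^ (3 * n)) = \<theta>"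
      by (rule power_power_fixed_field) (simp add: fixed_field_iff \<theta>)
    thus ?thesis
      using that K3
      by (simp add: fixed_field_iff \<phi>_def frob_add_ac power_mult_distrib power2_eq_square flip: to_ac_power)
  qed
  have "\<phi> ` V = ?L"
  proof (rule card_subset_eq)
    show "card (\<phi> ` V) = card ?L"
      using n_pos by (simp only: card_image[OF inj] card_V) (simp add: card_fixed_field_ac)
  qed (use \<phi>_L n_pos in \<open>auto intro: finite_fixed_field_ac\<close>)
  \<comment> \<open>The map z -> a z^(q^3) transported to \<open>V\<close>; values outside
    \<open>V\<close> are irrelevant.\<close>
  define f where "f v = inv_into V \<phi> (a * \<phi> v ^ (q ^ 3))" for v
  have mem: "a * \<phi> v ^ (q ^ 3) \<in> \<phi> ` V" if "v \<in> V" for v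
    unfolding \<open>\<phi> ` V = ?L\<close> using \<phi>_L[OF that] a(1) by (intro fixed_field_mult fixed_field_power)
  have fV: "f v \<in> V" and \<phi>_f: "\<phi> (f v) = a * \<phi> v ^ (q ^ 3)" if "v \<in> V" for v
    unfolding f_def using mem[OF that] by (rule inv_into_into, rule f_inv_into_f)
  show ?thesis
  proof (rule scattered_of_semilinear[of f 3])
    fix x y assume "x \<in> V" "y \<in> V"
    thus "f (x + y) = f x + f y"
      by (intro inj_onD[OF inj] fV V_add)
        (simp_all only: \<phi>_f \<phi>_add V_add frob_add_ac distrib_left)
  next
    fix c x assume "c \<in> K" "x \<in> V"
    thus "f (c *s x) = c ^ (q ^ 3) *s f x"
      by (intro inj_onD[OF inj] fV V_scale K_closed)
        (simp_all only: \<phi>_f \<phi>_scale V_scale power_mult_distrib to_ac_power mult.left_commute)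
  next
    fix c :: 'a assume "c \<in> K" "c ^ (q ^ 3) = c"
    thus "c ^ q = c"
      using power_fixed_gcd_3 n3 by (auto simp: fixed_field_iff)
  next
    fix x c d assume x: "x \<in> V" "x \<noteq> 0" and cd: "c \<in> K" "d \<in> K"
    show "f (f x) \<noteq> c *s x + d *s f x"
    proof
      assume "f (f x) = c *s x + d *s f x"
      hence "\<phi> (f (f x)) = to_ac c * \<phi> x + to_ac d * \<phi> (f x)"
        by (simp add: \<phi>_add \<phi>_scale)
      thus False
        using twisted_cubic_irreducible[OF n3 a \<phi>_L[OF x(1)] _ cd] \<phi>_0 x
        by (auto simp only: \<phi>_f fV)
    qed
  qed (rule fV)
qed

section \<open>The case where 3 divides n\<close>

lemma span_pair:
  fixes x y :: "'a ^ 3"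
  assumes "w \<in> vec.span {x, y}"
  obtains c d where "w = c *s x + d *s y"
proof -
  obtain c where "w - c *s x \<in> vec.span {y}"
    using assms by (auto simp: vec.span_breakdown_eq)
  then obtain d where "w - c *s x = d *s y"
    by (auto simp: vec.span_singleton)
  hence "w = c *s x + d *s y"
    by (metis add.commute diff_add_cancel)
  thus thesis
    by (rule that)
qed

lemma scattered_if_3_dvd:
  assumes n3: "3 dvd n"
  shows "\<exists>L. scattered_linear_set \<iota> (3 * n) L"
proof -
  obtain m where m: "n = 3 * m" "0 < m"
    using n3 n_pos by auto
  obtain a where a: "a \<in> K" "(a ^ norm_exponent q m) ^ q \<noteq> a ^ norm_exponent q m"
    using ex_norm_not_fixed[of q m, where ?'b = 'a] card_K m q_gt_1 by auto
  have "a \<noteq> 0"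
    using a(2) q_gt_1 norm_exponent_pos[OF m(2), of q] by (auto simp: power_0_left)
  define \<nu> where "\<nu> = a ^ norm_exponent q m"
  have \<nu>: "\<nu> ^ (q ^ 3) = \<nu>" "\<nu> ^ q \<noteq> \<nu>"
    unfolding \<nu>_def using norm_fixed[of a q m] a m(1) q_gt_1 by simp_all
  define f :: "'a ^ 3 \<Rightarrow> 'a ^ 3" where
    "f x = vector [a * (x $ 3) ^ q, (x $ 1) ^ q, (x $ 2) ^ q]" for x
  have f_add: "f (x + y) = f x + f y" for x y
    using frob_add[of _ _ 1] by (simp add: f_def vec_eq_iff forall_3 algebra_simps)
  have f_scale: "f (c *s x) = c ^ q *s f x" for c x
    by (simp add: f_def vec_eq_iff forall_3 power_mult_distrib)
  have fV: "f x \<in> V" if "x \<in> V" for x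
    using that a(1) by (auto simp: f_def forall_3 intro: K_closed)
  define l :: "'a ^ 3" where "l = vector [\<nu>, \<nu> ^ q, \<nu> ^ (q ^ 2)]"
  define D :: "'a ^ 3 \<Rightarrow> 'a ^ 3" where "D x = (\<chi> j. l $ j * x $ j)" for x
  \<comment> \<open>The cube of \<open>f\<close> preserves each axis and acts there by a twisted
    power map, so \<open>funpow_twisted\<close> computes its iterates.\<close>
  have fff: "f (f (f x)) = vector [a * x $ 1 ^ (q ^ 3), a ^ q * x $ 2 ^ (q ^ 3),
      a ^ (q ^ 2) * x $ 3 ^ (q ^ 3)]" for x
    by (simp add: f_def vec_eq_iff forall_3 power_mult_distrib power2_eq_square power3_eq_cube
        mult.assoc flip: power_mult)
  have iterate: "((\<lambda>x. f (f (f x))) ^^ k) x = vector [((\<lambda>z. a * z ^ (q ^ 3)) ^^ k) (x $ 1),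
      ((\<lambda>z. a ^ q * z ^ (q ^ 3)) ^^ k) (x $ 2), ((\<lambda>z. a ^ (q ^ 2) * z ^ (q ^ 3)) ^^ k) (x $ 3)]" for k x
    by (induction k) (simp_all add: fff vec_eq_iff forall_3)
  have D_eq: "((\<lambda>x. f (f (f x))) ^^ m) x = D x" if "x \<in> V" for x
  proof -
    \<comment> \<open>The norm of a conjugate of \<open>a\<close> is the corresponding conjugate of
      \<open>\<nu>\<close>.\<close>
    have swap: "(a ^ r) ^ s = (a ^ s) ^ r" for r s
      by (simp add: mult.commute flip: power_mult)
    show ?thesis
      using that unfolding iterate funpow_twisted
      by (simp add: D_def l_def vec_eq_iff forall_3 fixed_field_iff m(1) \<nu>_def swap[of _ "norm_exponent q m"])
  qed
  have distinct: "l $ 1 \<noteq> l $ 2" "l $ 2 \<noteq> l $ 3" "l $ 1 \<noteq> l $ 3"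
  proof -
    have l: "l $ 1 = \<nu>" "l $ 2 = \<nu> ^ q" "l $ 3 = (\<nu> ^ q) ^ q"
      by (simp_all add: l_def power2_eq_square flip: power_mult)
    show "l $ 1 \<noteq> l $ 2"
      using l \<nu> by simp
    show "l $ 2 \<noteq> l $ 3"
      using l \<nu>(2) frob_eq_iff[of \<nu> 1 "\<nu> ^ q"] by simp
    show "l $ 1 \<noteq> l $ 3"
    proof
      assume "l $ 1 = l $ 3"
      hence "\<nu> ^ q = ((\<nu> ^ q) ^ q) ^ q"
        using l by simp
      also have "\<dots> = \<nu> ^ (q ^ 3)"
        by (simp add: power3_eq_cube mult.assoc flip: power_mult)
      finally show False
        using \<nu> by simp
    qed
  qed
  show ?thesis
  proof (rule scattered_of_semilinear[of f 1])
    fix x c d assume x: "x \<in> V" "x \<noteq> 0"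
    show "f (f x) \<noteq> c *s x + d *s f x"
    proof
      assume ff: "f (f x) = c *s x + d *s f x"
      \<comment> \<open>The span is taken over all of \<open>'a\<close>, not just \<open>K\<close>;
        invariance and the dimension bound work there as well.\<close>
      define W where "W = vec.span {x, f x}"
      have xW: "x \<in> W" "f x \<in> W"
        by (auto simp: W_def intro: vec.span_base)
      have W_lin: "s *s v + t *s w \<in> W" if "v \<in> W" "w \<in> W" for s t v w
        using that unfolding W_def by (intro vec.span_add vec.span_scale)
      have W_rep: "\<exists>s t. w = s *s x + t *s f x" if "w \<in> W" for w
        using that unfolding W_def by (metis span_pair)
      have fW: "f w \<in> W" if w: "w \<in> W" for w
      proof -
        obtain s t where "w = s *s x + t *s f x"
          using W_rep[OF w] by blast
        hence "f w = s ^ q *s f x + t ^ q *s f (f x)"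
          by (simp add: f_add f_scale)
        also have "\<dots> \<in> W"
          unfolding ff by (intro W_lin xW)
        finally show ?thesis .
      qed
      have iterW: "((\<lambda>x. f (f (f x))) ^^ k) w \<in> W" if "w \<in> W" for k w
        by (induction k) (simp_all add: fW that)
      \<comment> \<open>\<open>D_eq\<close> holds only on \<open>V\<close>, so it is used for
        \<open>x\<close> and \<open>f x\<close>; linearity of \<open>D\<close> then covers the rest
        of \<open>W\<close>.\<close>
      have DxW: "D x \<in> W" "D (f x) \<in> W"
        using iterW[OF xW(1), of m] iterW[OF xW(2), of m]
        unfolding D_eq[OF x(1)] D_eq[OF fV[OF x(1)]] .
      have DW: "D w \<in> W" if w: "w \<in> W" for w
      proof -
        obtain s t where "w = s *s x + t *s f x"
          using W_rep[OF w] by blast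
        hence "D w = s *s D x + t *s D (f x)"
          by (simp add: D_def vec_eq_iff algebra_simps)
        thus ?thesis
          using W_lin DxW by simp
      qed
      have scaleW: "s *s w \<in> W" if "w \<in> W" for s w
        using that unfolding W_def by (rule vec.span_scale)
      have project: "axis j 1 \<in> W"
        if jk: "l $ j \<noteq> l $ i" "l $ j \<noteq> l $ k" "UNIV = {i, j, k}" "x $ j \<noteq> 0" for i j k
      proof -
        \<comment> \<open>This is (D - l_i)(D - l_k) applied to \<open>x\<close>, which kills
          coordinates \<open>i\<close> and \<open>k\<close> but not \<open>j\<close>. The factors 1
          fit the shape of \<open>W_lin\<close>.\<close>
        define v where "v = 1 *s (1 *s D (D x) + (- (l $ i + l $ k)) *s D x) + (l $ i * l $ k) *s x"
        have "v \<in> W"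
          unfolding v_def by (intro W_lin DW xW)
        have v_nth: "v $ r = (l $ r - l $ i) * (l $ r - l $ k) * x $ r" for r
          by (simp add: v_def D_def algebra_simps)
        define s where "s = (l $ j - l $ i) * (l $ j - l $ k) * x $ j"
        have "s \<noteq> 0"
          using jk by (simp add: s_def)
        have "(1 / s) *s v = axis j 1"
        proof (subst vec_eq_iff, intro allI)
          fix r
          have "r = i \<or> r = j \<or> r = k"
            using jk(3) by blast
          thus "((1 / s) *s v) $ r = axis j 1 $ r"
            using \<open>s \<noteq> 0\<close> jk(1,2) by (auto simp: v_nth axis_def s_def)
        qed
        thus ?thesis
          using scaleW[OF \<open>v \<in> W\<close>, of "1 / s"] by simp
      qed
      \<comment> \<open>\<open>f\<close> permutes the axes cyclically up to the factor
        \<open>a\<close>, so one unit vector in \<open>W\<close> yields all three.\<close>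
      have shift: "axis 2 1 \<in> W" if "axis 1 1 \<in> W"
      proof -
        have "f (axis 1 1) = axis 2 1"
          using q_gt_1 by (simp add: f_def vec_eq_iff forall_3 axis_def)
        thus ?thesis
          using fW[OF that] by simp
      qed
      have shift': "axis 3 1 \<in> W" if "axis 2 1 \<in> W"
      proof -
        have "f (axis 2 1) = axis 3 1"
          using q_gt_1 by (simp add: f_def vec_eq_iff forall_3 axis_def)
        thus ?thesis
          using fW[OF that] by simp
      qed
      have shift'': "axis 1 1 \<in> W" if "axis 3 1 \<in> W"
      proof -
        have "(1 / a) *s f (axis 3 1) = axis 1 1"
          using q_gt_1 \<open>a \<noteq> 0\<close> by (simp add: f_def vec_eq_iff forall_3 axis_def)
        thus ?thesis
          using scaleW[OF fW[OF that], of "1 / a"] by simp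
      qed
      have "x $ 1 \<noteq> 0 \<or> x $ 2 \<noteq> 0 \<or> x $ 3 \<noteq> 0"
        using x(2) by (auto simp: vec_eq_iff forall_3)
      hence "axis 1 1 \<in> W \<or> axis 2 1 \<in> W \<or> axis 3 1 \<in> W"
        using project[of 1 2 3] project[of 2 1 3] project[of 3 1 2] distinct UNIV_3
        by (auto simp: insert_commute)
      hence axes: "\<forall>j. axis j 1 \<in> W"
        using shift shift' shift'' unfolding forall_3 by blast
      have "(\<Sum>j\<in>UNIV. w $ j *s axis j 1) \<in> W" for w
        unfolding W_def by (intro vec.span_sum vec.span_scale) (use axes in \<open>simp add: W_def\<close>)
      hence "w \<in> W" for w
        unfolding basis_expansion .
      hence "W = UNIV"
        by blast
      hence "vec.dim W = CARD(3)"
        by (simp only: vec_dim_card)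
      moreover have "vec.dim W \<le> card {x, f x}"
        unfolding W_def vec.dim_span by (rule vec.dim_le_card') simp
      moreover have "card {x, f x} \<le> 2"
        by (simp add: card_insert_if)
      ultimately show False
        by simp
    qed
  qed (use fV in \<open>simp_all add: f_add f_scale\<close>)
qed

end

theorem theorem2p5:
  fixes n q :: nat
    and \<iota> :: "'q::{field,finite} \<Rightarrow> 'a::{field,finite}"
  assumes "n \<ge> 2"
    and "primepow q"
    and "CARD('q) = q"
    and "CARD('a) = q ^ (2 * n)"
    and "field_embedding \<iota>"
  shows "(\<not> [n = 0] (mod 3) \<longrightarrow> (\<exists>L. scattered_linear_set \<iota> (3 * n) L)) \<and>
         ([n = 0] (mod 3) \<longrightarrow> [q = 1] (mod 3) \<longrightarrow> (\<exists>L. scattered_linear_set \<iota> (3 * n) L))"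
proof -
  interpret scattered_construction n q \<iota>
    using assms by unfold_locales auto
  show ?thesis
    using scattered_if_not_3_dvd scattered_if_3_dvd by blast
qed

end
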